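(* For all nonnegative integers $p,q,\rho$, the Hamming ball $B_\rho[p,q]$, partially ordered by strict inclusion $\subsetneq$, is a LYM poset.
   Context: Let $p,q,\rho$ be nonnegative integers. The Hamming ball $B_\rho[p,q]$ is the family of all subsets $S\subseteq\{1,\dots,p+q\}$ whose symmetric difference with $\{1,\dots,p\}$ has at most $\rho$ elements (i.e. $S$ is at graph distance at most $\rho$ from $\{1,\dots,p\}$ in the hypercube graph on $2^{[p+q]}$, whose edges join sets differing in exactly one element). It is ordered by strict inclusion. For a finite poset $(P,<)$, the rank $r:P\to\{0,1,2,\dots\}$ is defined recursively by $r(x')=0$ if no $x\in P$ satisfies $x<x'$, and $r(x')=\max\{r(x): x<x'\}+1$ otherwise. The layer $P_k$ is the set of elements of rank $k$. An antichain is a subset $A\subseteq P$ in which any two distinct elements are incomparable. $P$ is called a LYM poset if every antichain $A\subseteq P$ satisfies $\sum_{x\in A}\frac{1}{|P_{r(x)}|}\le 1$. *)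

theory Defs
  imports Complex_Main
begin

definition finite_poset :: "'a set \<Rightarrow> ('a \<Rightarrow> 'a \<Rightarrow> bool) \<Rightarrow> bool" where
  "finite_poset P lt \<longleftrightarrow> finite P \<and> irreflp_on P lt \<and> transp_on P lt"

(* Well-founded recursion along the order of P, cf. poset_rank_rec below. The value is only
   meaningful for elements of a finite poset P. *)
definition poset_rank :: "'a set \<Rightarrow> ('a \<Rightarrow> 'a \<Rightarrow> bool) \<Rightarrow> 'a \<Rightarrow> nat" where
  "poset_rank P lt = wfrec {(y, x). y \<in> P \<and> x \<in> P \<and> lt y x}
     (\<lambda>r x. if {y \<in> P. lt y x} = {} then 0 else Max (r ` {y \<in> P. lt y x}) + 1)"

definition layer :: "'a set \<Rightarrow> ('a \<Rightarrow> 'a \<Rightarrow> bool) \<Rightarrow> nat \<Rightarrow> 'a set" where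
  "layer P lt k = {x \<in> P. poset_rank P lt x = k}"

definition antichain_in :: "'a set \<Rightarrow> ('a \<Rightarrow> 'a \<Rightarrow> bool) \<Rightarrow> 'a set \<Rightarrow> bool" where
  "antichain_in P lt A \<longleftrightarrow>
     A \<subseteq> P \<and> (\<forall>x\<in>A. \<forall>y\<in>A. x \<noteq> y \<longrightarrow> \<not> lt x y \<and> \<not> lt y x)"

definition LYM_poset :: "'a set \<Rightarrow> ('a \<Rightarrow> 'a \<Rightarrow> bool) \<Rightarrow> bool" where
  "LYM_poset P lt \<longleftrightarrow> finite_poset P lt \<and>
     (\<forall>A. antichain_in P lt A \<longrightarrow>
        (\<Sum>x\<in>A. 1 / real (card (layer P lt (poset_rank P lt x)))) \<le> 1)"

definition hamming_ball :: "nat \<Rightarrow> nat \<Rightarrow> nat \<Rightarrow> nat set set" where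
  "hamming_ball \<rho> p q = {S. S \<subseteq> {1..p+q} \<and> card (sym_diff S {1..p}) \<le> \<rho>}"

lemma finite_poset_wf:
  assumes "finite_poset P lt"
  shows "wf {(y, x). y \<in> P \<and> x \<in> P \<and> lt y x}" (is "wf ?R")
proof (rule finite_acyclic_wf)
  show "finite ?R"
    by (rule finite_subset[of _ "P \<times> P"]) (use assms in \<open>auto simp: finite_poset_def\<close>)
  have "trans ?R"
    using assms unfolding finite_poset_def trans_def transp_on_def by blast
  moreover have "irrefl ?R"
    using assms unfolding finite_poset_def irrefl_def irreflp_on_def by blast
  ultimately show "acyclic ?R"
    by (simp add: acyclic_irrefl)
qed

lemma poset_rank_rec:
  assumes "finite_poset P lt" and "x \<in> P"
  shows "poset_rank P lt x =
    (if {y \<in> P. lt y x} = {} then 0 else Max (poset_rank P lt ` {y \<in> P. lt y x}) + 1)"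
proof -
  let ?R = "{(y, x). y \<in> P \<and> x \<in> P \<and> lt y x}"
  have "cut f ?R x ` {y \<in> P. lt y x} = f ` {y \<in> P. lt y x}" for f :: "_ \<Rightarrow> nat"
    using assms(2) by (intro image_cong) (auto simp: cut_apply)
  then show ?thesis
    unfolding poset_rank_def by (subst wfrec[OF finite_poset_wf[OF assms(1)]]) simp
qed

end

theory Submission
  imports Defs
begin

text \<open>In the Hamming ball the rank of \<open>S\<close> is \<open>card S\<close> up to a constant, so a layer splits into
  types according to \<open>j = card (S - {1..p})\<close>, the type with parameter \<open>j\<close> in level \<open>n\<close> having
  \<open>(p choose (n - j)) * (q choose j)\<close> elements if it lies in the ball. Removing an element of a
  set of type \<open>j\<close> leads to type \<open>j\<close> or \<open>j - 1\<close>, and each of these bipartite graphs is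
  biregular. Hence normalized matching between adjacent levels reduces to the existence of a flow
  on a path of types. By log-concavity of binomial coefficients the two distributions of types are
  comparable in the likelihood ratio order in both required directions, a property that survives
  the truncation to the ball, and this gives the flow. Finally, normalized matching allows one to
  push the top level of an antichain down to its shadow until it lies in the lowest level.\<close>

section \<open>From normalized matching to the LYM inequality\<close>

definition level :: "'a set set \<Rightarrow> nat \<Rightarrow> 'a set set" where
  "level P n = {S \<in> P. card S = n}"

definition level_shadow :: "'a set set \<Rightarrow> nat \<Rightarrow> 'a set set \<Rightarrow> 'a set set" where
  "level_shadow P n F = {T \<in> level P n. \<exists>S\<in>F. T \<subset> S}"

lemma sum_level_le_1:
  assumes "finite P" and "A \<subseteq> level P n"
  shows "(\<Sum>S\<in>A. 1 / real (card (level P (card S)))) \<le> 1"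
proof -
  have fin: "finite (level P n)"
    using assms(1) by (simp add: level_def)
  have "(\<Sum>S\<in>A. 1 / real (card (level P (card S)))) = (\<Sum>S\<in>A. 1 / real (card (level P n)))"
    using assms(2) by (intro sum.cong) (auto simp: level_def)
  also have "\<dots> = real (card A) / real (card (level P n))"
    by simp
  also have "\<dots> \<le> 1"
    using card_mono[OF fin assms(2)] by (cases "card (level P n) = 0") simp_all
  finally show ?thesis .
qed

text \<open>Induction on \<open>k\<close>, a bound on how far the antichain reaches above level
  \<open>d\<close>. The part \<open>F\<close> in the top level is exchanged for its shadow
  \<open>G\<close>: the result is again an antichain, and by \<open>matching\<close> its weight is
  at least as large.\<close>

lemma normalized_matching_imp_LYM:
  fixes P :: "'a set set"
  assumes finP: "finite P" and fin: "\<And>S. S \<in> P \<Longrightarrow> finite S"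
    and low: "\<And>S. S \<in> P \<Longrightarrow> d \<le> card S"
    and nonempty: "\<And>n. d \<le> n \<Longrightarrow> level P (Suc n) \<noteq> {} \<Longrightarrow> level P n \<noteq> {}"
    and matching: "\<And>n F. d \<le> n \<Longrightarrow> F \<subseteq> level P (Suc n) \<Longrightarrow>
      card F * card (level P n) \<le> card (level_shadow P n F) * card (level P (Suc n))"
    and A: "antichain_in P (\<subset>) A"
  shows "(\<Sum>S\<in>A. 1 / real (card (level P (card S)))) \<le> 1"
proof -
  define wt where "wt S = 1 / real (card (level P (card S)))" for S :: "'a set"
  have bounded: "sum wt A \<le> 1"
    if "antichain_in P (\<subset>) A" "\<forall>S\<in>A. card S \<le> d + k" for A k
    using that
  proof (induction k arbitrary: A)
    case 0
    then have "A \<subseteq> level P d"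
      using low by (force simp: level_def antichain_in_def)
    then show ?case
      unfolding wt_def by (rule sum_level_le_1[OF finP])
  next
    case (Suc k)
    define n where "n = d + k"
    define F where "F = A \<inter> level P (Suc n)"
    define G where "G = level_shadow P n F"
    have sub: "A \<subseteq> P" and incomp: "\<And>S T. S \<in> A \<Longrightarrow> T \<in> A \<Longrightarrow> \<not> S \<subset> T"
      using Suc.prems(1) by (auto simp: antichain_in_def)
    have small: "card S \<le> n" if "S \<in> A - F" for S
    proof -
      have "card S \<noteq> Suc n"
        using that sub by (auto simp: F_def level_def)
      moreover have "card S \<le> Suc n"
        using that Suc.prems(2) by (auto simp: n_def)
      ultimately show ?thesis by simp
    qed
    have finA: "finite A" and finG: "finite G"
      using finP sub by (auto simp: G_def level_shadow_def level_def intro: finite_subset)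
    have FA: "F \<subseteq> A"
      by (simp add: F_def)
    \<comment> \<open>A member of \<open>G\<close> lies strictly below a member of \<open>F\<close>,
      hence cannot itself belong to the antichain \<open>A\<close>.\<close>
    have disj: "(A - F) \<inter> G = {}"
      using incomp FA unfolding G_def level_shadow_def by blast
    have GP: "G \<subseteq> P"
      by (auto simp: G_def level_shadow_def level_def)
    have above: "\<not> T \<subset> S" if "T \<in> G" "S \<in> A - F \<union> G" for S T
    proof
      assume "T \<subset> S"
      have "S \<in> P" "card S \<le> n" "card T = n"
        using that small sub by (auto simp: G_def level_shadow_def level_def)
      then show False
        using psubset_card_mono[OF fin \<open>T \<subset> S\<close>] by simp
    qed
    have below: "\<not> S \<subset> T" if "T \<in> G" "S \<in> A - F" for S T
      using that incomp FA unfolding G_def level_shadow_def by blast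
    have "\<not> S \<subset> T" if "S \<in> A - F \<union> G" "T \<in> A - F \<union> G" for S T
      using that above[of S T] below[of T S] incomp[of S T] by auto
    then have "antichain_in P (\<subset>) (A - F \<union> G)"
      using sub GP unfolding antichain_in_def by auto
    moreover have "\<forall>S\<in>A - F \<union> G. card S \<le> d + k"
      using small by (auto simp: G_def level_shadow_def level_def n_def)
    ultimately have IH: "sum wt (A - F \<union> G) \<le> 1"
      by (rule Suc.IH)
    have "sum wt F \<le> sum wt G"
    proof (cases "F = {}")
      case True
      then show ?thesis by (simp add: wt_def sum_nonneg)
    next
      case False
      then have "level P (Suc n) \<noteq> {}"
        by (auto simp: F_def)
      \<comment> \<open>Both denominators must be positive: with an empty level \<open>n\<close>,
        \<open>matching\<close> would only say \<open>0 \<le> 0\<close>.\<close>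
      moreover from this have "level P n \<noteq> {}"
        by (rule nonempty[rotated]) (simp add: n_def)
      ultimately have pos: "card (level P n) > 0" "card (level P (Suc n)) > 0"
        using finP by (auto simp: level_def card_gt_0_iff)
      have "sum wt F = (\<Sum>S\<in>F. 1 / real (card (level P (Suc n))))"
        by (intro sum.cong) (auto simp: wt_def F_def level_def)
      also have "\<dots> = real (card F) / real (card (level P (Suc n)))"
        by simp
      also have "\<dots> \<le> real (card G) / real (card (level P n))"
      proof -
        have "card F * card (level P n) \<le> card G * card (level P (Suc n))"
          unfolding G_def by (intro matching) (auto simp: F_def n_def)
        then have "real (card F * card (level P n)) \<le> real (card G * card (level P (Suc n)))"
          by (simp only: of_nat_le_iff)
        then show ?thesis
          using pos by (simp add: field_simps)
      qed
      also have "\<dots> = (\<Sum>T\<in>G. 1 / real (card (level P n)))"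
        by simp
      also have "\<dots> = sum wt G"
        by (intro sum.cong) (auto simp: wt_def G_def level_shadow_def level_def)
      finally show ?thesis .
    qed
    moreover have "sum wt A = sum wt (A - F) + sum wt F"
      by (rule sum.subset_diff[OF FA finA])
    moreover have "sum wt (A - F \<union> G) = sum wt (A - F) + sum wt G"
      using finA finG disj by (intro sum.union_disjoint) auto
    ultimately show ?case
      using IH by linarith
  qed
  have "finite A"
    using A finP by (auto simp: antichain_in_def intro: finite_subset)
  then have "\<forall>S\<in>A. card S \<le> d + Max (card ` A)"
    by (simp add: trans_le_add2)
  from bounded[OF A this] show ?thesis
    by (simp add: wt_def)
qed

section \<open>Flows on a path\<close>

text \<open>Both sides share the product of the two sums below \<open>t\<close>. What remains are
  cross terms with \<open>j < t \<le> k\<close>, which compare one by one. The products avoid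
  quotients, so zero weights are allowed.\<close>

lemma likelihood_ratio_partial_sums:
  fixes a b :: "nat \<Rightarrow> real"
  assumes lr: "\<And>j k. j < k \<Longrightarrow> a j * b k \<le> a k * b j" and "t \<le> N"
  shows "sum a {..<t} * sum b {..<N} \<le> sum a {..<N} * sum b {..<t}"
proof -
  have split: "sum f {..<N} = sum f {..<t} + sum f {t..<N}" for f :: "nat \<Rightarrow> real"
    using sum.union_disjoint[of "{..<t}" "{t..<N}" f] \<open>t \<le> N\<close>
    by (simp add: ivl_disj_int ivl_disj_un)
  have "sum a {..<t} * sum b {t..<N} = (\<Sum>j<t. \<Sum>k\<in>{t..<N}. a j * b k)"
    by (rule sum_product)
  also have "\<dots> \<le> (\<Sum>j<t. \<Sum>k\<in>{t..<N}. a k * b j)"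
    by (intro sum_mono lr) auto
  also have "\<dots> = sum b {..<t} * sum a {t..<N}"
    by (simp add: sum_product mult.commute)
  finally show ?thesis
    by (simp add: split algebra_simps)
qed

text \<open>The flow sends \<open>\<phi> j\<close> from \<open>a j\<close> to \<open>b j\<close> and \<open>\<psi> (Suc j)\<close> from \<open>a (Suc j)\<close> to \<open>b j\<close>;
  on a path it is determined by its marginals, and the partial sum comparisons say that it is
  nonnegative.\<close>

lemma path_flow_matching:
  fixes a b f g :: "nat \<Rightarrow> real"
  assumes lr1: "\<And>j k. j < k \<Longrightarrow> a j * b k \<le> a k * b j"
    and lr2: "\<And>j k. j < k \<Longrightarrow> b j * a (Suc k) \<le> b k * a (Suc j)"
    and a0: "\<And>j. 0 \<le> a j" and b0: "\<And>j. 0 \<le> b j" and bN: "b N = 0"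
    and g1: "\<And>j. b j * f j \<le> g j" and g2: "\<And>j. b j * f (Suc j) \<le> g j"
  shows "sum b {..<N} * (\<Sum>j<Suc N. a j * f j) \<le> sum a {..<Suc N} * sum g {..<N}"
proof -
  define Wa where "Wa = sum a {..<Suc N}"
  define Wb where "Wb = sum b {..<N}"
  \<comment> \<open>Scale the sources to \<open>Wb * a j\<close> and the demands to
    \<open>Wa * b j\<close>, so that the totals agree. All supply below \<open>j\<close> goes to
    demands below \<open>j\<close>; the deficit there is \<open>\<psi> j\<close>, to be met by
    source \<open>j\<close>. Dually, \<open>\<phi> j\<close> is what sources up to \<open>j\<close>
    have left after the demands below \<open>j\<close>.\<close>
  define \<psi> where "\<psi> j = Wa * sum b {..<j} - Wb * sum a {..<j}" for j
  define \<phi> where "\<phi> j = Wb * sum a {..<Suc j} - Wa * sum b {..<j}" for j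
  have Wb: "Wb = sum b {..<Suc N}"
    by (simp add: Wb_def bN)
  have Wa0: "0 \<le> Wa"
    by (simp add: Wa_def sum_nonneg a0 del: sum.lessThan_Suc)
  have psi0: "0 \<le> \<psi> j" if "j \<le> Suc N" for j
    using likelihood_ratio_partial_sums[of a b j "Suc N", OF lr1 that]
    by (simp add: \<psi>_def Wb Wa_def algebra_simps del: sum.lessThan_Suc)
  have phi0: "0 \<le> \<phi> j" if "j \<le> N" for j
  proof -
    \<comment> \<open>The bound on \<open>\<phi>\<close> compares \<open>b\<close> with the shifted
      sequence, as in \<open>lr2\<close>; the missing term \<open>a 0\<close> is restored by
      monotonicity of the partial sums of \<open>b\<close>.\<close>
    define a' where "a' i = a (Suc i)" for i
    have "sum b {..<j} * sum a' {..<N} \<le> sum b {..<N} * sum a' {..<j}"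
      by (rule likelihood_ratio_partial_sums[OF _ that]) (simp add: a'_def lr2)
    moreover have "sum b {..<j} \<le> sum b {..<N}"
      using that by (intro sum_mono2) (auto simp: b0)
    ultimately have "sum b {..<j} * (a 0 + sum a' {..<N}) \<le> sum b {..<N} * (a 0 + sum a' {..<j})"
      by (simp add: distrib_left add_mono mult_right_mono a0)
    then show ?thesis
      by (simp add: \<phi>_def Wa_def Wb_def a'_def sum.lessThan_Suc_shift mult.commute
          del: sum.lessThan_Suc)
  qed
  have phiN: "\<phi> N = 0"
    by (simp add: \<phi>_def Wa_def Wb_def mult.commute)
  have "Wb * (\<Sum>j<Suc N. a j * f j) = (\<Sum>j<Suc N. \<phi> j * f j + \<psi> j * f j)"
    unfolding sum_distrib_left
    by (intro sum.cong) (simp_all add: \<phi>_def \<psi>_def algebra_simps)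
  also have "\<dots> = (\<Sum>j<Suc N. \<phi> j * f j) + (\<Sum>j<Suc N. \<psi> j * f j)"
    by (rule sum.distrib)
  \<comment> \<open>Regroup from sources to targets; the boundary flows \<open>\<phi> N\<close> and
    \<open>\<psi> 0\<close> vanish.\<close>
  also have "\<dots> = (\<Sum>j<N. \<phi> j * f j + \<psi> (Suc j) * f (Suc j))"
  proof -
    have "(\<Sum>j<Suc N. \<phi> j * f j) = (\<Sum>j<N. \<phi> j * f j)"
      by (simp add: phiN)
    moreover have "(\<Sum>j<Suc N. \<psi> j * f j) = (\<Sum>j<N. \<psi> (Suc j) * f (Suc j))"
      by (subst sum.lessThan_Suc_shift) (simp add: \<psi>_def)
    ultimately show ?thesis
      by (simp add: sum.distrib)
  qed
  also have "\<dots> \<le> (\<Sum>j<N. Wa * g j)"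
  proof (rule sum_mono)
    fix j assume "j \<in> {..<N}"
    \<comment> \<open>The inflow of target \<open>j\<close> totals \<open>Wa * b j\<close>, and
      \<open>g1\<close>, \<open>g2\<close> bound \<open>b j\<close> times either density, hence
      times their maximum.\<close>
    then have "\<phi> j * f j + \<psi> (Suc j) * f (Suc j)
        \<le> \<phi> j * max (f j) (f (Suc j)) + \<psi> (Suc j) * max (f j) (f (Suc j))"
      by (intro add_mono mult_left_mono phi0 psi0) auto
    also have "\<dots> = Wa * (b j * max (f j) (f (Suc j)))"
      by (simp add: \<phi>_def \<psi>_def algebra_simps)
    also have "\<dots> \<le> Wa * g j"
      using g1[of j] g2[of j] by (intro mult_left_mono Wa0) (simp add: max_def)
    finally show "\<phi> j * f j + \<psi> (Suc j) * f (Suc j) \<le> Wa * g j" .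
  qed
  finally show ?thesis
    by (simp add: Wa_def Wb_def sum_distrib_left)
qed

section \<open>Binomial coefficients and local shadows\<close>

lemma Suc_times_binomial_Suc: "Suc k * (n choose Suc k) = (n - k) * (n choose k)"
proof (cases "k \<le> n")
  case True
  then show ?thesis
    by (metis binomial_absorb_comp binomial_absorption mult.commute)
next
  case False
  then show ?thesis by simp
qed

text \<open>The ratio of consecutive coefficients, \<open>(n - l) / Suc l\<close>, decreases in
  \<open>l\<close>. Multiplying by \<open>Suc l * Suc m\<close> clears the denominators and also
  covers vanishing coefficients.\<close>

lemma binomial_log_concave:
  assumes "m \<le> l"
  shows "(n choose Suc l) * (n choose m) \<le> (n choose Suc m) * (n choose l)"
proof -
  have "(Suc l * Suc m) * ((n choose Suc l) * (n choose m))
      = (Suc l * (n choose Suc l)) * Suc m * (n choose m)"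
    by (simp only: mult_ac)
  also have "\<dots> = ((n - l) * Suc m) * ((n choose l) * (n choose m))"
    unfolding Suc_times_binomial_Suc by (simp only: mult_ac)
  also have "\<dots> \<le> ((n - m) * Suc l) * ((n choose l) * (n choose m))"
    using assms by (intro mult_right_mono mult_mono) auto
  also have "\<dots> = ((n - m) * (n choose m)) * Suc l * (n choose l)"
    by (simp only: mult_ac)
  also have "\<dots> = (Suc l * Suc m) * ((n choose Suc m) * (n choose l))"
    unfolding Suc_times_binomial_Suc[symmetric] by (simp only: mult_ac)
  finally show ?thesis
    unfolding mult_le_cancel1 by simp
qed

text \<open>Double counting of the pairs \<open>(S, u)\<close> with
  \<open>u \<in> S \<inter> U\<close>, sent injectively to \<open>(S - {u}, u)\<close>: each
  \<open>S\<close> gives \<open>Suc i\<close> pairs, each \<open>T\<close> receives at most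
  \<open>card U - i\<close>. The binomials encode this ratio. Outside \<open>U\<close> the sets are
  arbitrary.\<close>

lemma local_shadow_bound:
  assumes "finite U" and "finite F" and "finite G"
    and F: "\<And>S. S \<in> F \<Longrightarrow> card (S \<inter> U) = Suc i"
    and G: "\<And>T. T \<in> G \<Longrightarrow> card (T \<inter> U) = i"
    and FG: "\<And>S u. S \<in> F \<Longrightarrow> u \<in> S \<inter> U \<Longrightarrow> S - {u} \<in> G"
  shows "card F * (card U choose i) \<le> card G * (card U choose Suc i)"
proof -
  let ?L = "SIGMA S:F. S \<inter> U" and ?R = "SIGMA T:G. U - T"
  have "card (U - T) = card U - i" if "T \<in> G" for T
    using card_Diff_subset_Int[of U T] G[OF that] \<open>finite U\<close> by (simp add: Int_commute)
  then have R: "card ?R = card G * (card U - i)"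
    using assms by (simp add: card_SigmaI)
  have L: "card ?L = card F * Suc i"
    using assms by (simp add: card_SigmaI)
  have "inj_on (\<lambda>(S, u). (S - {u}, u)) ?L"
    by (auto simp: inj_on_def)
  moreover have "(\<lambda>(S, u). (S - {u}, u)) ` ?L \<subseteq> ?R"
    using FG by auto
  moreover have "finite ?R"
    using assms by auto
  ultimately have le: "card F * Suc i \<le> card G * (card U - i)"
    unfolding L[symmetric] R[symmetric] by (rule card_inj_on_le)
  have "Suc i * (card F * (card U choose i)) = card F * Suc i * (card U choose i)"
    by (simp only: mult_ac)
  also have "\<dots> \<le> card G * (card U - i) * (card U choose i)"
    by (rule mult_right_mono[OF le]) simp
  also have "\<dots> = Suc i * (card G * (card U choose Suc i))"
    using Suc_times_binomial_Suc[of i "card U"] by (simp only: mult_ac)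
  finally show ?thesis
    unfolding mult_le_cancel1 by simp
qed

lemma card_subsets_by_type:
  assumes "finite U" "finite V" "U \<inter> V = {}"
  shows "card {S. S \<subseteq> U \<union> V \<and> card (S \<inter> U) = i \<and> card (S \<inter> V) = j}
    = (card U choose i) * (card V choose j)"
proof -
  have "bij_betw (\<lambda>S. (S \<inter> U, S \<inter> V))
      {S. S \<subseteq> U \<union> V \<and> card (S \<inter> U) = i \<and> card (S \<inter> V) = j}
      ({X. X \<subseteq> U \<and> card X = i} \<times> {Y. Y \<subseteq> V \<and> card Y = j})"
    by (rule bij_betw_byWitness[where f' = "\<lambda>(X, Y). X \<union> Y"])
      (use assms(3) in \<open>auto simp: Int_Un_distrib2 Int_absorb2 Int_commute
        intro!: arg_cong[where f = card]\<close>)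
  then show ?thesis
    using assms by (simp add: bij_betw_same_card card_cartesian_product n_subsets)
qed

section \<open>The Hamming ball\<close>

lemma ground_set_split: "{1..p + q} = {1..p} \<union> {p<..p + q::nat}"
  by auto

lemma card_split:
  assumes "S \<subseteq> {1..p + q::nat}"
  shows "card S = card (S \<inter> {1..p}) + card (S \<inter> {p<..p + q})"
proof -
  have "S = (S \<inter> {1..p}) \<union> (S \<inter> {p<..p + q})"
    using assms by auto
  then have "card S = card ((S \<inter> {1..p}) \<union> (S \<inter> {p<..p + q}))"
    by simp
  also have "\<dots> = card (S \<inter> {1..p}) + card (S \<inter> {p<..p + q})"
    by (rule card_Un_disjoint) auto
  finally show ?thesis .
qed

text \<open>The distance from \<open>{1..p}\<close> is the number of elements above \<open>p\<close>
  plus the number missing from \<open>{1..p}\<close>; stated additively to avoid truncated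
  subtraction.\<close>

lemma hamming_ball_iff:
  "S \<in> hamming_ball \<rho> p q \<longleftrightarrow>
    S \<subseteq> {1..p + q} \<and> p + card (S \<inter> {p<..p + q}) \<le> \<rho> + card (S \<inter> {1..p})"
proof (cases "S \<subseteq> {1..p + q}")
  case True
  have "card (sym_diff S {1..p}) = card ((S \<inter> {p<..p + q}) \<union> ({1..p} - S))"
    using True by (intro arg_cong[where f = card]) auto
  also have "\<dots> = card (S \<inter> {p<..p + q}) + card ({1..p} - S)"
    by (rule card_Un_disjoint) auto
  finally have "card (sym_diff S {1..p}) = card (S \<inter> {p<..p + q}) + card ({1..p} - S)" .
  moreover have "card ({1..p} - S) + card (S \<inter> {1..p}) = p"
    using card_Int_Diff[of "{1..p}" S] by (simp add: Int_commute)
  ultimately show ?thesis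
    using True unfolding hamming_ball_def by auto
next
  case False
  then show ?thesis by (simp add: hamming_ball_def)
qed

lemma finite_hamming_ball: "finite (hamming_ball \<rho> p q)"
  by (rule finite_subset[of _ "Pow {1..p + q}"]) (auto simp: hamming_ball_def)

lemma finite_in_hamming_ball: "S \<in> hamming_ball \<rho> p q \<Longrightarrow> finite S"
  by (auto simp: hamming_ball_def intro: finite_subset)

lemma hamming_ball_card_ge:
  assumes "S \<in> hamming_ball \<rho> p q"
  shows "p - \<rho> \<le> card S"
  using assms card_split[of S p q] by (auto simp: hamming_ball_iff)

text \<open>Deleting an element above \<open>p\<close> brings the set closer to
  \<open>{1..p}\<close>. If there is none, the distance is \<open>p - card S\<close>, and the size
  hypothesis leaves room for one more step.\<close>

lemma hamming_ball_remove:
  assumes S: "S \<in> hamming_ball \<rho> p q" and "p - \<rho> < card S"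
  obtains e where "e \<in> S" and "S - {e} \<in> hamming_ball \<rho> p q"
proof (cases "S \<inter> {p<..p + q} = {}")
  case True
  then have card: "card S = card (S \<inter> {1..p})"
    using card_split[of S p q] S by (simp add: hamming_ball_iff)
  with assms(2) have "card (S \<inter> {1..p}) > 0"
    by simp
  then obtain e where e: "e \<in> S" "e \<in> {1..p}"
    unfolding card_gt_0_iff by blast
  have "card ((S - {e}) \<inter> {1..p}) = card S - 1"
    using e unfolding card Int_Diff[symmetric] Diff_Int_distrib2 by simp
  moreover have "card ((S - {e}) \<inter> {p<..p + q}) = 0"
    using True by (simp add: Diff_Int_distrib2)
  moreover have "S - {e} \<subseteq> {1..p + q}"
    using S by (auto simp: hamming_ball_iff)
  ultimately have "S - {e} \<in> hamming_ball \<rho> p q"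
    using assms(2) unfolding hamming_ball_iff by linarith
  with e that show ?thesis by blast
next
  case False
  then obtain e where e: "e \<in> S" "e \<in> {p<..p + q}"
    by blast
  have "(S - {e}) \<inter> {1..p} = S \<inter> {1..p}"
    using e by auto
  moreover have "card ((S - {e}) \<inter> {p<..p + q}) \<le> card (S \<inter> {p<..p + q})"
    by (intro card_mono) auto
  moreover have "S - {e} \<subseteq> {1..p + q}"
    using S by (auto simp: hamming_ball_iff)
  ultimately show ?thesis
    using S that[OF e(1)] unfolding hamming_ball_iff by simp
qed

section \<open>Rank and layers of the ball\<close>

lemma finite_poset_hamming_ball: "finite_poset (hamming_ball \<rho> p q) (\<subset>)"
  by (auto simp: finite_poset_def finite_hamming_ball irreflp_on_def transp_on_def)

text \<open>Strong induction on size: above the bottom level, deleting a suitable element gives a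
  predecessor of size \<open>card S - 1\<close>, which attains the maximum; on the bottom level
  there are no predecessors.\<close>

lemma hamming_ball_rank:
  assumes "S \<in> hamming_ball \<rho> p q"
  shows "poset_rank (hamming_ball \<rho> p q) (\<subset>) S = card S - (p - \<rho>)"
  using assms
proof (induction "card S" arbitrary: S rule: less_induct)
  case less
  let ?H = "hamming_ball \<rho> p q"
  let ?B = "{T \<in> ?H. T \<subset> S}"
  have smaller: "card T < card S" if "T \<in> ?B" for T
    using that finite_in_hamming_ball[OF less.prems] by (auto intro: psubset_card_mono)
  have image: "poset_rank ?H (\<subset>) ` ?B = (\<lambda>T. card T - (p - \<rho>)) ` ?B"
    using less.hyps smaller by (intro image_cong) auto
  have rec: "poset_rank ?H (\<subset>) S =
      (if ?B = {} then 0 else Max ((\<lambda>T. card T - (p - \<rho>)) ` ?B) + 1)"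
    using poset_rank_rec[OF finite_poset_hamming_ball less.prems] unfolding image .
  show ?case
  proof (cases "p - \<rho> < card S")
    case True
    then obtain e where e: "e \<in> S" "S - {e} \<in> ?H"
      using hamming_ball_remove[OF less.prems] by blast
    then have eB: "S - {e} \<in> ?B"
      by auto
    have "Max ((\<lambda>T. card T - (p - \<rho>)) ` ?B) = card S - 1 - (p - \<rho>)"
    proof (rule Max_eqI)
      show "finite ((\<lambda>T. card T - (p - \<rho>)) ` ?B)"
        using finite_hamming_ball by simp
      show "card S - 1 - (p - \<rho>) \<in> (\<lambda>T. card T - (p - \<rho>)) ` ?B"
        using eB e by (intro rev_image_eqI[OF eB]) simp
    next
      fix m assume "m \<in> (\<lambda>T. card T - (p - \<rho>)) ` ?B"
      then obtain T where "T \<in> ?B" "m = card T - (p - \<rho>)"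
        by blast
      then show "m \<le> card S - 1 - (p - \<rho>)"
        using smaller[of T] by simp
    qed
    moreover have "?B \<noteq> {}"
      using eB by blast
    ultimately show ?thesis
      unfolding rec using True by simp
  next
    case False
    have "?B = {}"
    proof (rule ccontr)
      assume "?B \<noteq> {}"
      then obtain T where "T \<in> ?B"
        by blast
      then show False
        using smaller[of T] hamming_ball_card_ge[of T \<rho> p q] False by auto
    qed
    then show ?thesis
      unfolding rec using False by simp
  qed
qed

text \<open>All sizes in the ball are at least \<open>p - \<rho>\<close>, so truncated subtraction
  of this offset is injective on them.\<close>

lemma hamming_ball_layer:
  assumes "S \<in> hamming_ball \<rho> p q"
  shows "layer (hamming_ball \<rho> p q) (\<subset>) (poset_rank (hamming_ball \<rho> p q) (\<subset>) S)
    = level (hamming_ball \<rho> p q) (card S)"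
proof -
  have "card T - (p - \<rho>) = card S - (p - \<rho>) \<longleftrightarrow> card T = card S"
    if "T \<in> hamming_ball \<rho> p q" for T
    using hamming_ball_card_ge[OF that] hamming_ball_card_ge[OF assms] by linarith
  then show ?thesis
    using assms by (auto simp: layer_def level_def hamming_ball_rank)
qed

section \<open>Counting the sets of a level by type\<close>

definition type_count :: "nat \<Rightarrow> nat \<Rightarrow> nat \<Rightarrow> nat \<Rightarrow> nat \<Rightarrow> nat" where
  "type_count \<rho> p q n j =
    (if j \<le> n \<and> p + 2 * j \<le> \<rho> + n then (p choose (n - j)) * (q choose j) else 0)"

text \<open>With \<open>j\<close> elements above \<open>p\<close> and \<open>n - j\<close> in
  \<open>{1..p}\<close>, the ball condition becomes \<open>p + 2 * j \<le> \<rho> + n\<close>. The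
  guard \<open>j \<le> n\<close> keeps the truncated \<open>n - j = 0\<close> from producing
  spurious sets.\<close>

lemma card_hamming_ball_type:
  "card {S \<in> level (hamming_ball \<rho> p q) n. card (S \<inter> {p<..p + q}) = j} = type_count \<rho> p q n j"
proof (cases "j \<le> n \<and> p + 2 * j \<le> \<rho> + n")
  case True
  have "{S \<in> level (hamming_ball \<rho> p q) n. card (S \<inter> {p<..p + q}) = j}
      = {S. S \<subseteq> {1..p} \<union> {p<..p + q} \<and> card (S \<inter> {1..p}) = n - j \<and> card (S \<inter> {p<..p + q}) = j}"
    unfolding level_def hamming_ball_iff ground_set_split[symmetric]
    using True by (auto simp: card_split)
  also have "card \<dots> = (p choose (n - j)) * (q choose j)"
    by (subst card_subsets_by_type) auto
  finally show ?thesis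
    using True by (simp add: type_count_def)
next
  case False
  then have "{S \<in> level (hamming_ball \<rho> p q) n. card (S \<inter> {p<..p + q}) = j} = {}"
    unfolding level_def hamming_ball_iff by (auto simp: card_split)
  then have "card {S \<in> level (hamming_ball \<rho> p q) n. card (S \<inter> {p<..p + q}) = j} = 0"
    by (simp only: card.empty)
  then show ?thesis
    using False by (auto simp: type_count_def)
qed

lemma card_eq_sum_types:
  assumes "finite F" and "F \<subseteq> level (hamming_ball \<rho> p q) n" and "n < N"
  shows "card F = (\<Sum>j<N. card {S \<in> F. card (S \<inter> {p<..p + q}) = j})"
proof -
  have "card (S \<inter> {p<..p + q}) < N" if "S \<in> F" for S
    using that assms(2,3) card_split[of S p q]
    by (force simp: level_def hamming_ball_iff)
  then have "F = (\<Union>j<N. {S \<in> F. card (S \<inter> {p<..p + q}) = j})"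
    by auto
  then have "card F = card (\<Union>j<N. {S \<in> F. card (S \<inter> {p<..p + q}) = j})"
    by simp
  also have "\<dots> = (\<Sum>j<N. card {S \<in> F. card (S \<inter> {p<..p + q}) = j})"
    using assms(1) by (intro card_UN_disjoint) auto
  finally show ?thesis .
qed

text \<open>The factors from \<open>q\<close> agree on both sides, leaving log-concavity for
  \<open>p\<close>. The guard for type \<open>k\<close> in level \<open>n\<close> implies the other
  three, so truncation can only make the left side vanish.\<close>

lemma type_count_lr_down:
  assumes "j < k"
  shows "type_count \<rho> p q (Suc n) j * type_count \<rho> p q n k
    \<le> type_count \<rho> p q (Suc n) k * type_count \<rho> p q n j"
proof (cases "k \<le> n \<and> p + 2 * k \<le> \<rho> + n")
  case True
  then have "(p choose Suc (n - j)) * (p choose (n - k)) \<le> (p choose Suc (n - k)) * (p choose (n - j))"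
    using assms by (intro binomial_log_concave) simp
  then have "((p choose Suc (n - j)) * (p choose (n - k))) * ((q choose j) * (q choose k))
      \<le> ((p choose Suc (n - k)) * (p choose (n - j))) * ((q choose j) * (q choose k))"
    by (rule mult_right_mono) simp
  then show ?thesis
    using True assms by (simp add: type_count_def Suc_diff_le mult_ac)
next
  case False
  then show ?thesis by (auto simp: type_count_def)
qed

text \<open>Now the factors from \<open>p\<close> agree, since \<open>Suc n - Suc k = n - k\<close>,
  and log-concavity for \<open>q\<close> remains. The guard for \<open>Suc k\<close> in level
  \<open>Suc n\<close> implies the others.\<close>

lemma type_count_lr_up:
  assumes "j < k"
  shows "type_count \<rho> p q n j * type_count \<rho> p q (Suc n) (Suc k)
    \<le> type_count \<rho> p q n k * type_count \<rho> p q (Suc n) (Suc j)"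
proof (cases "Suc k \<le> Suc n \<and> p + 2 * Suc k \<le> \<rho> + Suc n")
  case True
  have "(q choose Suc k) * (q choose j) \<le> (q choose Suc j) * (q choose k)"
    using assms by (intro binomial_log_concave) simp
  then have "((q choose Suc k) * (q choose j)) * ((p choose (n - j)) * (p choose (n - k)))
      \<le> ((q choose Suc j) * (q choose k)) * ((p choose (n - j)) * (p choose (n - k)))"
    by (rule mult_right_mono) simp
  then show ?thesis
    using True assms by (simp add: type_count_def mult_ac)
next
  case False
  then show ?thesis by (auto simp: type_count_def)
qed

section \<open>Shadows of a family, type by type\<close>

context
  fixes \<rho> p q n :: nat and F G :: "nat set set"
  assumes F: "F \<subseteq> level (hamming_ball \<rho> p q) (Suc n)"
  defines "G \<equiv> level_shadow (hamming_ball \<rho> p q) n F"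
begin

private abbreviation (input) part :: "nat set set \<Rightarrow> nat \<Rightarrow> nat set set" where
  "part A j \<equiv> {S \<in> A. card (S \<inter> {p<..p + q}) = j}"

lemma finite_level_family: "finite F" "finite G"
  using F finite_hamming_ball[of \<rho> p q]
  by (auto simp: G_def level_shadow_def level_def intro: finite_subset)

lemma part_le: "card (part F j) \<le> type_count \<rho> p q (Suc n) j"
proof -
  have "finite (level (hamming_ball \<rho> p q) (Suc n))"
    using finite_hamming_ball[of \<rho> p q] by (simp add: level_def)
  then show ?thesis
    unfolding card_hamming_ball_type[symmetric] using F by (intro card_mono) auto
qed

lemma in_level_shadow:
  assumes "S \<in> F" "u \<in> S" "p + card ((S - {u}) \<inter> {p<..p + q}) \<le> \<rho> + card ((S - {u}) \<inter> {1..p})"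
  shows "S - {u} \<in> G"
proof -
  have S: "S \<subseteq> {1..p + q}" "card S = Suc n"
    using assms(1) F by (auto simp: level_def hamming_ball_iff)
  then have "S - {u} \<in> hamming_ball \<rho> p q"
    using assms(3) by (auto simp: hamming_ball_iff)
  moreover have "card (S - {u}) = n" "S - {u} \<subset> S"
    using S assms(2) by auto
  ultimately show ?thesis
    using assms(1) unfolding G_def level_shadow_def level_def by blast
qed

text \<open>Deleting an element of \<open>{1..p}\<close> keeps the type but increases the distance;
  the guard of \<open>type_count\<close> in level \<open>n\<close> says exactly that the result
  stays in the ball.\<close>

lemma type_shadow_same:
  "card (part F j) * type_count \<rho> p q n j \<le> card (part G j) * type_count \<rho> p q (Suc n) j"
proof (cases "j \<le> n \<and> p + 2 * j \<le> \<rho> + n")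
  case True
  have "card (part F j) * (card {1..p} choose (n - j)) \<le> card (part G j) * (card {1..p} choose Suc (n - j))"
  proof (rule local_shadow_bound)
    show "finite {1..p}" "finite (part F j)" "finite (part G j)"
      using finite_level_family by auto
  next
    fix S assume "S \<in> part F j"
    then show "card (S \<inter> {1..p}) = Suc (n - j)"
      using F True card_split[of S p q] by (auto simp: level_def hamming_ball_iff)
  next
    fix T assume "T \<in> part G j"
    then show "card (T \<inter> {1..p}) = n - j"
      using True card_split[of T p q]
      by (auto simp: G_def level_shadow_def level_def hamming_ball_iff)
  next
    fix S u assume S: "S \<in> part F j" and u: "u \<in> S \<inter> {1..p}"
    have "card (S \<inter> {1..p}) = Suc (n - j)"
      using S F True card_split[of S p q] by (auto simp: level_def hamming_ball_iff)
    then have "card ((S - {u}) \<inter> {1..p}) = n - j"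
      using u by (simp add: Diff_Int_distrib2)
    moreover have "(S - {u}) \<inter> {p<..p + q} = S \<inter> {p<..p + q}"
      using u by auto
    ultimately have "card ((S - {u}) \<inter> {1..p}) = n - j" "card ((S - {u}) \<inter> {p<..p + q}) = j"
      using S by simp_all
    moreover from this have "S - {u} \<in> G"
      using S u True by (intro in_level_shadow) auto
    ultimately show "S - {u} \<in> part G j"
      by simp
  qed
  then have "card (part F j) * (p choose (n - j)) * (q choose j)
      \<le> card (part G j) * (p choose Suc (n - j)) * (q choose j)"
    by (intro mult_right_mono) simp_all
  then show ?thesis
    using True by (simp add: type_count_def Suc_diff_le mult_ac)
next
  case False
  then show ?thesis by (auto simp: type_count_def)
qed

text \<open>Deleting an element above \<open>p\<close> lowers the type by one and the distance too,
  so the result is always in the ball.\<close>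

lemma type_shadow_pred:
  "card (part F (Suc j)) * type_count \<rho> p q n j \<le> card (part G j) * type_count \<rho> p q (Suc n) (Suc j)"
proof (cases "p + 2 * Suc j \<le> \<rho> + Suc n \<and> j \<le> n")
  case True
  have "card (part F (Suc j)) * (card {p<..p + q} choose j)
      \<le> card (part G j) * (card {p<..p + q} choose Suc j)"
  proof (rule local_shadow_bound)
    show "finite {p<..p + q}" "finite (part F (Suc j))" "finite (part G j)"
      using finite_level_family by auto
  next
    fix S u assume S: "S \<in> part F (Suc j)" and u: "u \<in> S \<inter> {p<..p + q}"
    have "p + Suc j \<le> \<rho> + card (S \<inter> {1..p})"
      using S F by (auto simp: level_def hamming_ball_iff)
    moreover have shadow_type: "card ((S - {u}) \<inter> {p<..p + q}) = j"
      using S u by (simp add: Diff_Int_distrib2)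
    moreover have "(S - {u}) \<inter> {1..p} = S \<inter> {1..p}"
      using u by auto
    ultimately have "S - {u} \<in> G"
      using S u by (intro in_level_shadow) simp_all
    with shadow_type show "S - {u} \<in> part G j"
      by simp
  qed auto
  then have "card (part F (Suc j)) * (q choose j) * (p choose (n - j))
      \<le> card (part G j) * (q choose Suc j) * (p choose (n - j))"
    by (intro mult_right_mono) simp_all
  then show ?thesis
    using True by (simp add: type_count_def mult_ac)
next
  case False
  \<comment> \<open>Type \<open>j\<close> may still occur in level \<open>n\<close>, so the left
    side vanishes for another reason: no set of type \<open>Suc j\<close> is available to
    \<open>F\<close>.\<close>
  have "card (part F (Suc j)) \<le> type_count \<rho> p q (Suc n) (Suc j)"
    by (rule part_le)
  also have "\<dots> = 0"
    using False by (auto simp: type_count_def)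
  finally show ?thesis
    by simp
qed

lemma hamming_ball_matching:
  "card F * card (level (hamming_ball \<rho> p q) n) \<le> card G * card (level (hamming_ball \<rho> p q) (Suc n))"
proof -
  let ?H = "hamming_ball \<rho> p q"
  define a where "a j = real (type_count \<rho> p q (Suc n) j)" for j
  define b where "b j = real (type_count \<rho> p q n j)" for j
  \<comment> \<open>The density of \<open>F\<close> within type \<open>j\<close>. If
    \<open>a j = 0\<close>, it is \<open>0\<close> by division by zero, and \<open>part F j\<close>
    is empty by \<open>part_le\<close>.\<close>
  define f where "f j = real (card (part F j)) / a j" for j
  define g where "g j = real (card (part G j))" for j
  \<comment> \<open>Level \<open>n\<close> has types \<open>0\<close> to \<open>n\<close> and level
    \<open>Suc n\<close> has one more, matching the \<open>N\<close> targets and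
    \<open>Suc N\<close> sources of the path.\<close>
  define N where "N = Suc n"
  have fin: "finite (level ?H m)" for m
    using finite_hamming_ball[of \<rho> p q] by (simp add: level_def)
  have af: "a j * f j = real (card (part F j))" for j
    using part_le[of j] by (auto simp: a_def f_def)
  have scale: "b j * f i \<le> g j"
    if "card (part F i) * type_count \<rho> p q n j \<le> card (part G j) * type_count \<rho> p q (Suc n) i" for i j
  proof (cases "a i = 0")
    case True
    then show ?thesis by (simp add: f_def g_def)
  next
    case False
    then have "a i > 0"
      by (simp add: a_def)
    moreover have "real (card (part F i)) * b j \<le> g j * a i"
      using that unfolding a_def b_def g_def by (simp only: of_nat_mult[symmetric] of_nat_le_iff)
    ultimately show ?thesis
      by (simp add: f_def field_simps)
  qed
  have "sum b {..<N} * (\<Sum>j<Suc N. a j * f j) \<le> sum a {..<Suc N} * sum g {..<N}"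
  proof (rule path_flow_matching)
    show "a j * b k \<le> a k * b j" if "j < k" for j k
      unfolding a_def b_def using type_count_lr_down[OF that]
      by (simp only: of_nat_mult[symmetric] of_nat_le_iff)
    show "b j * a (Suc k) \<le> b k * a (Suc j)" if "j < k" for j k
      unfolding a_def b_def using type_count_lr_up[OF that]
      by (simp only: of_nat_mult[symmetric] of_nat_le_iff)
    show "b N = 0"
      by (simp add: b_def N_def type_count_def)
    show "b j * f j \<le> g j" "b j * f (Suc j) \<le> g j" for j
      by (rule scale[OF type_shadow_same] scale[OF type_shadow_pred])+
  qed (auto simp: a_def b_def)
  moreover have "sum b {..<N} = real (card (level ?H n))"
    using card_eq_sum_types[OF fin subset_refl, of n N]
    by (simp add: N_def b_def card_hamming_ball_type)
  moreover have "sum a {..<Suc N} = real (card (level ?H (Suc n)))"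
    using card_eq_sum_types[OF fin subset_refl, of "Suc n" "Suc N"]
    by (simp add: N_def a_def card_hamming_ball_type)
  moreover have "(\<Sum>j<Suc N. a j * f j) = real (card F)"
    using card_eq_sum_types[OF finite_level_family(1) F, of "Suc N"]
    by (simp add: N_def af)
  moreover have "sum g {..<N} = real (card G)"
    using card_eq_sum_types[OF finite_level_family(2), of \<rho> p q n N]
    by (simp add: N_def g_def G_def level_shadow_def)
  ultimately have "real (card (level ?H n) * card F) \<le> real (card (level ?H (Suc n)) * card G)"
    by simp
  then show ?thesis
    by (simp only: of_nat_le_iff mult.commute)
qed

end

theorem theorem4:
  fixes p q \<rho> :: nat
  shows "LYM_poset (hamming_ball \<rho> p q) (\<subset>)"
  unfolding LYM_poset_def
proof (intro conjI allI impI)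
  let ?H = "hamming_ball \<rho> p q"
  show "finite_poset ?H (\<subset>)"
    by (rule finite_poset_hamming_ball)
  fix A assume A: "antichain_in ?H (\<subset>) A"
  \<comment> \<open>No level is skipped: a set above the bottom level can lose an element without
    leaving the ball.\<close>
  have nonempty: "level ?H n \<noteq> {}" if "p - \<rho> \<le> n" "level ?H (Suc n) \<noteq> {}" for n
  proof -
    from that(2) obtain S where S: "S \<in> ?H" "card S = Suc n"
      by (auto simp: level_def)
    with that(1) have "p - \<rho> < card S"
      by simp
    with S(1) obtain e where "e \<in> S" "S - {e} \<in> ?H"
      by (rule hamming_ball_remove)
    then have "S - {e} \<in> level ?H n"
      using S by (simp add: level_def)
    then show ?thesis by blast
  qed
  have "(\<Sum>S\<in>A. 1 / real (card (layer ?H (\<subset>) (poset_rank ?H (\<subset>) S))))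
      = (\<Sum>S\<in>A. 1 / real (card (level ?H (card S))))"
    using A by (intro sum.cong) (auto simp: antichain_in_def hamming_ball_layer)
  also have "\<dots> \<le> 1"
    by (rule normalized_matching_imp_LYM[OF finite_hamming_ball finite_in_hamming_ball
          hamming_ball_card_ge nonempty hamming_ball_matching A])
  finally show "(\<Sum>S\<in>A. 1 / real (card (layer ?H (\<subset>) (poset_rank ?H (\<subset>) S)))) \<le> 1" .
qed

end
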